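(* Let $n\ge 3$, $\alpha\in(0,n)$, $p,q>0$ and $\sigma_1,\sigma_2\in[0,\alpha)$. Then the system of integral equations $$u(x)=c_1(x)\int_{\mathbb{R}^n}\frac{v(y)^q}{|x-y|^{n-\alpha}|y|^{\sigma_1}}\,dy,\qquad v(x)=c_2(x)\int_{\mathbb{R}^n}\frac{u(y)^p}{|x-y|^{n-\alpha}|y|^{\sigma_2}}\,dy$$ admits a positive solution $(u,v)$ for some double bounded functions $c_1(x)$ and $c_2(x)$ if and only if $pq>1$ and $$\max\left\{\frac{\alpha(q+1)-(\sigma_1+\sigma_2 q)}{pq-1},\ \frac{\alpha(p+1)-(\sigma_2+\sigma_1 p)}{pq-1}\right\}<n-\alpha.$$
   Context: A function $c:\mathbb{R}^n\to\mathbb{R}$ is double bounded if there exists $C>0$ such that $1/C\le c(x)\le C$ for all $x\in\mathbb{R}^n$. A positive solution is a pair $(u,v)$ of positive, finite-valued (measurable) functions on $\mathbb{R}^n$ satisfying the system pointwise. *)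

theory Defs
  imports "HOL-Analysis.Analysis"
begin

definition double_bounded :: "('a \<Rightarrow> real) \<Rightarrow> bool" where
  "double_bounded c \<longleftrightarrow> (\<exists>C>0. \<forall>x. 1 / C \<le> c x \<and> c x \<le> C)"

text \<open>
  The integral is a nonnegative Lebesgue integral, hence possibly infinite. Since
  \<open>0 powr s = 0\<close> and \<open>a / 0 = 0\<close>, the integrand is \<open>0\<close> at \<open>y = x\<close> and at \<open>y = 0\<close>
  (the latter even if \<open>\<sigma> = 0\<close>); these two points form a null set.
\<close>
definition weighted_riesz_integral ::
    "real \<Rightarrow> real \<Rightarrow> (real ^ 'n \<Rightarrow> real) \<Rightarrow> real ^ 'n \<Rightarrow> ennreal" where
  "weighted_riesz_integral \<alpha> \<sigma> f x =
     (\<integral>\<^sup>+ y. ennreal (f y / (norm (x - y) powr (real CARD('n) - \<alpha>) * norm y powr \<sigma>)) \<partial>lebesgue)"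

text \<open>
  The equations are stated in \<open>ennreal\<close>: as the left-hand sides are finite, they include the
  convergence of the integrals at every \<open>x\<close>. The coercion of \<open>c\<^sub>1 x\<close> and \<open>c\<^sub>2 x\<close> loses nothing
  for double bounded functions, which are positive.
\<close>
definition positive_solution ::
    "real \<Rightarrow> real \<Rightarrow> real \<Rightarrow> real \<Rightarrow> real \<Rightarrow> (real ^ 'n \<Rightarrow> real) \<Rightarrow> (real ^ 'n \<Rightarrow> real) \<Rightarrow>
     (real ^ 'n \<Rightarrow> real) \<Rightarrow> (real ^ 'n \<Rightarrow> real) \<Rightarrow> bool" where
  "positive_solution \<alpha> p q \<sigma>\<^sub>1 \<sigma>\<^sub>2 c\<^sub>1 c\<^sub>2 u v \<longleftrightarrow>
     u \<in> borel_measurable lebesgue \<and> v \<in> borel_measurable lebesgue \<and>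
     (\<forall>x. u x > 0) \<and> (\<forall>x. v x > 0) \<and>
     (\<forall>x. ennreal (u x) =
        ennreal (c\<^sub>1 x) * weighted_riesz_integral \<alpha> \<sigma>\<^sub>1 (\<lambda>y. v y powr q) x) \<and>
     (\<forall>x. ennreal (v x) =
        ennreal (c\<^sub>2 x) * weighted_riesz_integral \<alpha> \<sigma>\<^sub>2 (\<lambda>y. u y powr p) x)"

end

theory Submission
  imports Defs
begin

text \<open>
  Write \<open>n\<close> for the dimension, \<open>m = n - \<alpha>\<close>, and \<open>s\<close>, \<open>t\<close> for the two quotients in the condition. They
  are the exponents for which the powers \<open>|x| powr (-s)\<close>, \<open>|x| powr (-t)\<close> balance in the system, that
  is, the solution of \<open>s = t q + \<sigma>\<^sub>1 - \<alpha>\<close>, \<open>t = s p + \<sigma>\<^sub>2 - \<alpha>\<close>.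

  Sufficiency. The solution is \<open>u x = (1 + |x|) powr (-s)\<close>, \<open>v x = (1 + |x|) powr (-t)\<close>. As the
  coefficients are free up to double boundedness, only two-sided estimates are required: if
  \<open>\<alpha> < \<tau> + \<sigma> < n\<close>, then the weighted Riesz integral of \<open>(1 + |y|) powr (-\<tau>)\<close> is comparable with
  \<open>(1 + |x|) powr (-(\<tau> + \<sigma> - \<alpha>))\<close> (\<open>weighted_riesz_integral_decay_upper\<close>,
  \<open>weighted_riesz_integral_decay_lower\<close>). For \<open>\<tau> = t q\<close> the condition reads \<open>0 < s < m\<close>, and for
  \<open>\<tau> = s p\<close> it reads \<open>0 < t < m\<close>. The upper estimate splits the kernel into four radial powers, whose
  integrals are summed over dyadic shells.

  Necessity. Let \<open>M R\<close> be the integral of \<open>v powr q / |y| powr \<sigma>\<^sub>1\<close> over the ball of radius \<open>R\<close>. Finiteness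
  of \<open>u\<close> at the origin gives \<open>M R \<le> K * R powr m\<close>. On the other hand the system feeds the mass back to
  itself: the mass in the ball of radius \<open>R\<close> bounds \<open>u\<close> from below on the next annulus, this bounds \<open>v\<close>
  from below on the annulus after that, and the mass of this annulus belongs to \<open>M (4 R)\<close>. The result
  (\<open>supersolution_mass_growth\<close>) is
  \<open>M (4 R) \<ge> M R + c * R powr (D + m - m p q) * M R powr (p q)\<close> with \<open>D = \<alpha> (q + 1) - (\<sigma>\<^sub>1 + \<sigma>\<^sub>2 q) > 0\<close>.
  Unless \<open>p q > 1\<close> and \<open>D < m (p q - 1)\<close>, this recursion along \<open>R = 4 ^ k\<close> makes \<open>M\<close> grow faster than any
  exponential in \<open>k\<close> (\<open>exponents_if_exponentially_bounded\<close>), which the upper bound forbids. Exchanging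
  the two equations gives the second quotient. The lemmas are stated for supersolutions,
  for which multiples of \<open>u\<close> and \<open>v\<close> bound the integrals.
\<close>

section \<open>Integrals of radial powers\<close>

text \<open>
  Each point with \<open>f y \<noteq> 0\<close> is charged to one ball on which the constant dominates \<open>f y\<close>; overlaps of
  the balls only enlarge the right-hand side. With balls of geometrically
  growing or shrinking radii this replaces integration in polar coordinates.
\<close>
lemma nn_integral_le_suminf_ball:
  fixes x :: "'a::euclidean_space" and f :: "'a \<Rightarrow> real"
  assumes a: "\<And>k::nat. 0 \<le> a k" and r: "\<And>k. 0 \<le> r k"
    and sm: "summable (\<lambda>k. a k * r k ^ DIM('a))"
    and cover: "\<And>y. f y \<noteq> 0 \<Longrightarrow> \<exists>k. y \<in> ball x (r k) \<and> f y \<le> a k"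
  shows "(\<integral>\<^sup>+ y. ennreal (f y) \<partial>lebesgue)
           \<le> ennreal (unit_ball_vol (real DIM('a)) * (\<Sum>k. a k * r k ^ DIM('a)))"
proof -
  let ?\<kappa> = "unit_ball_vol (real DIM('a))"
  have "(\<integral>\<^sup>+ y. ennreal (f y) \<partial>lebesgue)
      \<le> (\<integral>\<^sup>+ y. (\<Sum>k. ennreal (a k) * indicator (ball x (r k)) y) \<partial>lebesgue)"
  proof (rule nn_integral_mono)
    fix y
    show "ennreal (f y) \<le> (\<Sum>k. ennreal (a k) * indicator (ball x (r k)) y)"
    proof (cases "f y = 0")
      case False
      then obtain k where k: "y \<in> ball x (r k)" "f y \<le> a k"
        using cover by blast
      define g where "g j = ennreal (a j) * indicator (ball x (r j)) y" for j
      have "ennreal (f y) \<le> g k"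
        using k by (simp add: g_def ennreal_leI)
      also have "\<dots> = sum g {k}" by simp
      also have "\<dots> \<le> suminf g" by (rule sum_le_suminf) auto
      also have "suminf g = (\<Sum>k. ennreal (a k) * indicator (ball x (r k)) y)"
        by (simp add: g_def[abs_def])
      finally show ?thesis .
    qed simp
  qed
  also have "\<dots> = (\<Sum>k. ennreal (a k) * emeasure lebesgue (ball x (r k)))"
    by (subst nn_integral_suminf) (auto simp: nn_integral_cmult_indicator
        intro!: borel_measurable_times_ennreal borel_measurable_indicator)
  also have "\<dots> = (\<Sum>k. ennreal (?\<kappa> * (a k * r k ^ DIM('a))))"
    using a r by (simp add: emeasure_ball ennreal_mult'[symmetric] mult_ac)
  also have "\<dots> = ennreal (?\<kappa> * (\<Sum>k. a k * r k ^ DIM('a)))"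
    using a r sm
    by (subst suminf_ennreal2) (auto simp: suminf_mult summable_mult unit_ball_vol_nonneg)
  finally show ?thesis .
qed

text \<open>
  On the shell \<open>R / 2 ^ (k + 1) \<le> |x - y| < R / 2 ^ k\<close> the integrand is comparable with a constant, and
  the shell contributes at most a multiple of \<open>(R / 2 ^ k) powr (n - \<gamma>)\<close>. As \<open>\<gamma> < n\<close>, these
  contributions form a convergent geometric series with ratio \<open>\<theta>\<close>.
\<close>
lemma nn_integral_norm_powr_ball_le:
  fixes \<gamma> :: real
  assumes "0 \<le> \<gamma>" "\<gamma> < real DIM('a::euclidean_space)"
  obtains K where "K > 0"
    "\<And>(x::'a) R. R > 0 \<Longrightarrow>
      (\<integral>\<^sup>+ y. ennreal (indicator (ball x R) y * norm (x - y) powr (-\<gamma>)) \<partial>lebesgue)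
        \<le> ennreal (K * R powr (real DIM('a) - \<gamma>))"
proof -
  let ?n = "real DIM('a)"
  let ?\<kappa> = "unit_ball_vol ?n"
  define \<theta> where "\<theta> = (1/2::real) powr (?n - \<gamma>)"
  have "\<theta> < (1/2) powr 0"
    unfolding \<theta>_def using assms by (intro powr_less_mono') auto
  then have \<theta>: "0 < \<theta>" "\<theta> < 1"
    by (auto simp: \<theta>_def)
  have "(\<integral>\<^sup>+ y. ennreal (indicator (ball x R) y * norm (x - y) powr (-\<gamma>)) \<partial>lebesgue)
        \<le> ennreal (?\<kappa> * 2 powr \<gamma> / (1 - \<theta>) * R powr (?n - \<gamma>))" if R: "R > 0" for x :: 'a and R
  proof -
    define r where "r k = R * (1/2) ^ k" for k :: nat
    define a where "a k = r (Suc k) powr (-\<gamma>)" for k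
    have r: "r k > 0" for k using R by (simp add: r_def)
    have "a k * r k ^ DIM('a) = 2 powr \<gamma> * R powr (?n - \<gamma>) * \<theta> ^ k" for k
    proof -
      have "r k ^ DIM('a) = r k powr ?n" using r by (simp add: powr_realpow)
      moreover have "a k = 2 powr \<gamma> * r k powr (-\<gamma>)"
        using R by (simp add: a_def r_def powr_mult powr_divide powr_minus field_simps)
      moreover have "r k powr (?n - \<gamma>) = R powr (?n - \<gamma>) * \<theta> ^ k"
        using R by (simp add: r_def \<theta>_def powr_mult powr_power powr_powr
            flip: powr_realpow) (simp add: mult.commute)
      ultimately show ?thesis
        by (simp add: mult.assoc powr_add[symmetric])
    qed
    note ar = this
    have "(\<integral>\<^sup>+ y. ennreal (indicator (ball x R) y * norm (x - y) powr (-\<gamma>)) \<partial>lebesgue)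
        \<le> ennreal (?\<kappa> * (\<Sum>k. a k * r k ^ DIM('a)))"
    proof (rule nn_integral_le_suminf_ball[where x = x])
      show "summable (\<lambda>k. a k * r k ^ DIM('a))"
        unfolding ar using \<theta> by (intro summable_mult summable_geometric) auto
      fix y assume "indicator (ball x R) y * norm (x - y) powr (-\<gamma>) \<noteq> 0"
      then have y: "0 < norm (x - y)" "norm (x - y) < R"
        by (auto simp: indicator_def dist_norm split: if_splits)
      define k where "k = (LEAST j. r (Suc j) \<le> norm (x - y))"
      have "(\<lambda>j. r (Suc j)) \<longlonglongrightarrow> R * 0"
        unfolding r_def by (intro tendsto_mult tendsto_const LIMSEQ_Suc LIMSEQ_power_zero) auto
      then have "eventually (\<lambda>j. r (Suc j) < norm (x - y)) sequentially"
        using y by (intro order_tendstoD(2)[of _ "R * 0"]) auto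
      then have ex: "\<exists>j. r (Suc j) \<le> norm (x - y)"
        by (meson eventually_happens' less_imp_le sequentially_bot)
      have 1: "r (Suc k) \<le> norm (x - y)" unfolding k_def by (rule LeastI_ex[OF ex])
      have 2: "norm (x - y) < r k"
      proof (cases k)
        case 0 then show ?thesis using y by (simp add: r_def)
      next
        case (Suc j)
        then show ?thesis using not_less_Least[of j "\<lambda>j. r (Suc j) \<le> norm (x - y)"]
          by (auto simp: k_def)
      qed
      have "norm (x - y) powr (-\<gamma>) \<le> a k"
        unfolding a_def using 1 r assms by (intro powr_mono2') auto
      with 2 y show "\<exists>k. y \<in> ball x (r k) \<and> indicator (ball x R) y * norm (x - y) powr (-\<gamma>) \<le> a k"
        by (intro exI[of _ k]) (auto simp: dist_norm)
    qed (auto simp: a_def less_imp_le[OF r])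
    also have "(\<Sum>k. a k * r k ^ DIM('a)) = 2 powr \<gamma> * R powr (?n - \<gamma>) * (1 / (1 - \<theta>))"
      unfolding ar using \<theta> by (subst suminf_mult) (auto simp: suminf_geometric intro: summable_geometric)
    finally show ?thesis by (simp add: mult_ac)
  qed
  moreover have "?\<kappa> * 2 powr \<gamma> / (1 - \<theta>) > 0"
    using \<theta> by (simp add: unit_ball_vol_pos)
  ultimately show thesis by (rule that[rotated])
qed

text \<open>
  The same decomposition with shells of growing radii \<open>R * 2 ^ k\<close>; now \<open>n < \<gamma>\<close> makes the series
  converge.
\<close>
lemma nn_integral_norm_powr_compl_ball_le:
  fixes \<gamma> :: real
  assumes "real DIM('a::euclidean_space) < \<gamma>"
  obtains K where "K > 0"
    "\<And>(x::'a) R. R > 0 \<Longrightarrow>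
      (\<integral>\<^sup>+ y. ennreal (indicator (- ball x R) y * norm (x - y) powr (-\<gamma>)) \<partial>lebesgue)
        \<le> ennreal (K * R powr (real DIM('a) - \<gamma>))"
proof -
  let ?n = "real DIM('a)"
  let ?\<kappa> = "unit_ball_vol ?n"
  define \<theta> where "\<theta> = (2::real) powr (?n - \<gamma>)"
  have "\<theta> < 2 powr 0"
    unfolding \<theta>_def using assms by (intro powr_less_mono) auto
  then have \<theta>: "0 < \<theta>" "\<theta> < 1"
    by (auto simp: \<theta>_def)
  have "(\<integral>\<^sup>+ y. ennreal (indicator (- ball x R) y * norm (x - y) powr (-\<gamma>)) \<partial>lebesgue)
        \<le> ennreal (?\<kappa> * 2 powr ?n / (1 - \<theta>) * R powr (?n - \<gamma>))" if R: "R > 0" for x :: 'a and R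
  proof -
    define r where "r k = R * 2 ^ k" for k :: nat
    define a where "a k = r k powr (-\<gamma>)" for k
    have r: "r k > 0" for k using R by (simp add: r_def)
    have "a k * r (Suc k) ^ DIM('a) = 2 powr ?n * R powr (?n - \<gamma>) * \<theta> ^ k" for k
    proof -
      have "r (Suc k) ^ DIM('a) = 2 powr ?n * r k powr ?n"
        using r[of k] by (simp add: powr_realpow r_def power_mult_distrib)
      moreover have "r k powr (?n - \<gamma>) = R powr (?n - \<gamma>) * \<theta> ^ k"
        using R by (simp add: r_def \<theta>_def powr_mult powr_power powr_powr
            flip: powr_realpow) (simp add: mult.commute)
      ultimately show ?thesis
        by (simp add: a_def mult_ac powr_add[symmetric])
    qed
    note ar = this
    have "(\<integral>\<^sup>+ y. ennreal (indicator (- ball x R) y * norm (x - y) powr (-\<gamma>)) \<partial>lebesgue)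
        \<le> ennreal (?\<kappa> * (\<Sum>k. a k * r (Suc k) ^ DIM('a)))"
    proof (rule nn_integral_le_suminf_ball[where x = x])
      show "summable (\<lambda>k. a k * r (Suc k) ^ DIM('a))"
        unfolding ar using \<theta> by (intro summable_mult summable_geometric) auto
      fix y assume "indicator (- ball x R) y * norm (x - y) powr (-\<gamma>) \<noteq> 0"
      then have y: "R \<le> norm (x - y)"
        by (auto simp: indicator_def dist_norm split: if_splits)
      define k where "k = (LEAST j. norm (x - y) < r (Suc j))"
      obtain j where "norm (x - y) / R < 2 ^ j"
        using real_arch_pow[of 2] by auto
      also have "(2::real) ^ j \<le> 2 ^ Suc j" by simp
      finally have ex: "\<exists>j. norm (x - y) < r (Suc j)"
        using R by (auto simp: r_def field_simps intro!: exI[of _ j])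
      have 1: "norm (x - y) < r (Suc k)" unfolding k_def by (rule LeastI_ex[OF ex])
      have 2: "r k \<le> norm (x - y)"
      proof (cases k)
        case 0 then show ?thesis using y by (simp add: r_def)
      next
        case (Suc j)
        then show ?thesis using not_less_Least[of j "\<lambda>j. norm (x - y) < r (Suc j)"]
          by (auto simp: k_def)
      qed
      have "norm (x - y) powr (-\<gamma>) \<le> a k"
        unfolding a_def using 2 r assms by (intro powr_mono2') auto
      with 1 y show "\<exists>k. y \<in> ball x (r (Suc k)) \<and> indicator (- ball x R) y * norm (x - y) powr (-\<gamma>) \<le> a k"
        by (intro exI[of _ k]) (auto simp: dist_norm)
    qed (auto simp: a_def less_imp_le[OF r])
    also have "(\<Sum>k. a k * r (Suc k) ^ DIM('a)) = 2 powr ?n * R powr (?n - \<gamma>) * (1 / (1 - \<theta>))"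
      unfolding ar using \<theta> by (subst suminf_mult) (auto simp: suminf_geometric intro: summable_geometric)
    finally show ?thesis by (simp add: mult_ac)
  qed
  moreover have "?\<kappa> * 2 powr ?n / (1 - \<theta>) > 0"
    using \<theta> by (simp add: unit_ball_vol_pos)
  ultimately show thesis by (rule that[rotated])
qed

section \<open>Elementary integral estimates\<close>

lemma borel_measurable_lebesgue_if_borel:
  "f \<in> borel_measurable borel \<Longrightarrow> f \<in> borel_measurable lebesgue"
  by (rule measurable_completion) simp

lemma borel_measurable_indicator_norm_powr:
  fixes x :: "'a::euclidean_space"
  assumes "A \<in> sets borel"
  shows "(\<lambda>y. indicator A y * norm (x - y) powr a) \<in> borel_measurable lebesgue"
  using assms
  by (intro borel_measurable_lebesgue_if_borel borel_measurable_times borel_measurable_indicator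
      powr_real_measurable borel_measurable_norm borel_measurable_diff) auto

lemma nn_integral_ge_const_mult_emeasure:
  assumes "A \<in> sets M" "0 \<le> k" "\<And>y. y \<in> A \<Longrightarrow> k \<le> f y"
  shows "ennreal k * emeasure M A \<le> (\<integral>\<^sup>+ y. ennreal (f y) \<partial>M)"
proof -
  have "ennreal k * emeasure M A = (\<integral>\<^sup>+ y. ennreal k * indicator A y \<partial>M)"
    using assms(1) by (simp add: nn_integral_cmult_indicator)
  also have "\<dots> \<le> (\<integral>\<^sup>+ y. ennreal (f y) \<partial>M)"
    using assms by (intro nn_integral_mono) (auto simp: indicator_def intro: ennreal_leI)
  finally show ?thesis .
qed

text \<open>
  The annulus \<open>R \<le> |y| < 2 R\<close> has volume \<open>(2 ^ n - 1) \<kappa> R ^ n\<close> with \<open>\<kappa>\<close> the volume of the unit ball, and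
  \<open>2 ^ n - 1 \<ge> 1\<close>. Only the order \<open>R ^ n\<close> matters for the growth estimates.
\<close>
lemma nn_integral_ge_annulus:
  fixes f :: "'a::euclidean_space \<Rightarrow> real"
  assumes "R > 0" "0 \<le> k" "\<And>y. R \<le> norm y \<Longrightarrow> norm y < 2 * R \<Longrightarrow> k \<le> f y"
  shows "ennreal (k * (unit_ball_vol (real DIM('a)) * R ^ DIM('a)))
           \<le> (\<integral>\<^sup>+ y. ennreal (f y) \<partial>lebesgue)"
proof -
  let ?\<kappa> = "unit_ball_vol (real DIM('a))" and ?A = "ball (0::'a) (2 * R) - ball 0 R"
  have "?\<kappa> * (2 * R) ^ DIM('a) = 2 ^ DIM('a) * (?\<kappa> * R ^ DIM('a))"
    by (simp add: power_mult_distrib)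
  also have "\<dots> \<ge> 2 * (?\<kappa> * R ^ DIM('a))"
    using \<open>R > 0\<close> self_le_power[of "2::real" "DIM('a)"] by (intro mult_right_mono) auto
  finally have "?\<kappa> * R ^ DIM('a) \<le> ?\<kappa> * (2 * R) ^ DIM('a) - ?\<kappa> * R ^ DIM('a)" by simp
  also have "ennreal \<dots> = emeasure lebesgue ?A"
    using \<open>R > 0\<close>
    by (subst emeasure_Diff) (auto simp: emeasure_ball ennreal_minus subset_ball)
  finally have "ennreal (?\<kappa> * R ^ DIM('a)) \<le> emeasure lebesgue ?A"
    by (simp add: ennreal_leI)
  then have "ennreal (k * (?\<kappa> * R ^ DIM('a))) \<le> ennreal k * emeasure lebesgue ?A"
    using \<open>0 \<le> k\<close> by (simp add: ennreal_mult' mult_left_mono)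
  also have "\<dots> \<le> (\<integral>\<^sup>+ y. ennreal (f y) \<partial>lebesgue)"
    using assms by (intro nn_integral_ge_const_mult_emeasure) (auto simp: dist_norm)
  finally show ?thesis .
qed

lemma nn_integral_add_le:
  fixes f g :: "'a \<Rightarrow> real"
  assumes "f \<in> borel_measurable M" "g \<in> borel_measurable M" "\<And>y. 0 \<le> f y" "\<And>y. 0 \<le> g y"
    and "(\<integral>\<^sup>+ y. ennreal (f y) \<partial>M) \<le> ennreal A" "(\<integral>\<^sup>+ y. ennreal (g y) \<partial>M) \<le> ennreal B"
    and "0 \<le> A" "0 \<le> B"
  shows "(\<integral>\<^sup>+ y. ennreal (f y + g y) \<partial>M) \<le> ennreal (A + B)"
  using assms by (simp add: nn_integral_add ennreal_plus add_mono)

lemma nn_integral_cmult_le: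
  fixes f :: "'a \<Rightarrow> real"
  assumes "f \<in> borel_measurable M" "(\<integral>\<^sup>+ y. ennreal (f y) \<partial>M) \<le> ennreal A" "0 \<le> c"
  shows "(\<integral>\<^sup>+ y. ennreal (c * f y) \<partial>M) \<le> ennreal (c * A)"
  using assms by (simp add: nn_integral_cmult ennreal_mult' mult_left_mono)

section \<open>Riesz potentials of power decay\<close>

text \<open>
  Here \<open>d = |x - y|\<close>, \<open>e = |y|\<close> and \<open>\<rho> = |x|\<close>. The four terms are radial powers around \<open>0\<close> or \<open>x\<close> on
  balls or complements of balls whose radii are comparable with \<open>r\<close> (or equal to \<open>1\<close>), and each of
  them integrates to a multiple of \<open>r powr (-s)\<close>, \<open>s = \<tau> + \<sigma> - \<alpha>\<close>. They cover the cases that \<open>y\<close> is far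
  from both \<open>0\<close> and \<open>x\<close>; that it is nearer to \<open>x\<close>, so that \<open>e \<ge> \<rho> / 2\<close>; and that it is nearer to \<open>0\<close>, so
  that \<open>d \<ge> \<rho> / 2\<close>. In the last case \<open>d\<close> is comparable with \<open>r\<close> only if it is not small; otherwise
  \<open>x\<close> and \<open>y\<close> are both bounded and \<open>r\<close> itself is comparable with \<open>1\<close>.
\<close>
lemma riesz_kernel_split:
  fixes d e \<rho> m \<tau> \<sigma> s :: real
  assumes pos: "d > 0" "e > 0" "0 \<le> \<rho>" and tri: "\<rho> \<le> d + e" "e \<le> \<rho> + d" "d \<le> \<rho> + e"
    and exps: "0 \<le> m" "0 \<le> \<tau>" "0 \<le> \<sigma>" "0 \<le> s"
  defines "r \<equiv> 1 + \<rho>"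
  shows "(1 + e) powr (-\<tau>) / (d powr m * e powr \<sigma>)
    \<le> 2 powr m * (if 2 * r \<le> e then e powr (-(m + \<tau> + \<sigma>)) else 0)
     + ((2 / r) powr \<tau> * (if d < 3 * r then d powr (-(\<sigma> + m)) else 0)
     + ((4 / r) powr m * (if e < 2 * r then e powr (-(\<tau> + \<sigma>)) else 0)
     + (3 / r) powr s * (if e < 1 then e powr (-(\<sigma> + m)) else 0)))"
    (is "?f \<le> ?T1 + (?T2 + (?T3 + ?T4))")
proof -
  have r: "r \<ge> 1" using pos by (simp add: r_def)
  have f: "?f = (1 + e) powr (-\<tau>) * d powr (-m) * e powr (-\<sigma>)"
    by (simp add: powr_minus field_simps)
  have T: "0 \<le> ?T1" "0 \<le> ?T2" "0 \<le> ?T3" "0 \<le> ?T4" by auto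
  have \<tau>e: "(1 + e) powr (-\<tau>) \<le> e powr (-\<tau>)"
    using pos exps by (intro powr_mono2') auto
  consider "2 * r \<le> e" | "e < 2 * r" "d \<le> e" | "e < 2 * r" "e < d" "1 \<le> d" | "e < 2 * r" "e < d" "d < 1"
    by linarith
  then show ?thesis
  proof cases
    case 1
    have "d powr (-m) \<le> (e / 2) powr (-m)"
      using 1 pos tri exps by (intro powr_mono2') (auto simp: r_def)
    also have "\<dots> = 2 powr m * e powr (-m)"
      using pos by (simp add: powr_divide powr_minus field_simps)
    finally have "?f \<le> e powr (-\<tau>) * (2 powr m * e powr (-m)) * e powr (-\<sigma>)"
      unfolding f using \<tau>e by (intro mult_mono mult_right_mono) auto
    also have "\<dots> = ?T1" using 1 by (simp add: powr_add powr_diff powr_minus field_simps)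
    finally show ?thesis using T by linarith
  next
    case 2
    have "(1 + e) powr (-\<tau>) \<le> (r / 2) powr (-\<tau>)"
      using 2 pos tri exps by (intro powr_mono2') (auto simp: r_def)
    also have "\<dots> = (2 / r) powr \<tau>"
      using r by (simp add: powr_divide powr_minus field_simps)
    finally have "?f \<le> (2 / r) powr \<tau> * d powr (-m) * d powr (-\<sigma>)"
      unfolding f using 2 pos exps by (intro mult_mono mult_right_mono powr_mono2') auto
    also have "\<dots> = ?T2" using 2 r by (simp add: powr_add powr_diff powr_minus field_simps)
    finally show ?thesis using T by linarith
  next
    case 3
    have "d powr (-m) \<le> (r / 4) powr (-m)"
      using 3 pos tri exps r by (intro powr_mono2') (auto simp: r_def)
    also have "\<dots> = (4 / r) powr m"
      using r by (simp add: powr_divide powr_minus field_simps)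
    finally have "?f \<le> e powr (-\<tau>) * (4 / r) powr m * e powr (-\<sigma>)"
      unfolding f using \<tau>e by (intro mult_mono mult_right_mono) auto
    also have "\<dots> = ?T3" using 3 by (simp add: powr_add powr_diff powr_minus field_simps)
    finally show ?thesis using T by linarith
  next
    case 4
    have "(1 + e) powr (-\<tau>) \<le> 1 powr (-\<tau>)"
      using pos exps by (intro powr_mono2') auto
    also have "\<dots> \<le> (3 / r) powr s"
      using 4 tri exps pos r by (auto intro!: ge_one_powr_ge_zero simp: r_def field_simps)
    finally have "?f \<le> (3 / r) powr s * e powr (-m) * e powr (-\<sigma>)"
      unfolding f using 4 pos exps by (intro mult_mono mult_right_mono powr_mono2') auto
    also have "\<dots> = ?T4" using 4 by (simp add: powr_add powr_diff powr_minus field_simps)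
    finally show ?thesis using T by linarith
  qed
qed

text \<open>
  The hypotheses are what makes the four radial integrals converge: \<open>\<sigma> < \<alpha>\<close> at the points \<open>0\<close> and \<open>x\<close>
  when these are close to each other, \<open>\<alpha> < \<tau> + \<sigma>\<close> at infinity, and \<open>\<tau> + \<sigma> < n\<close> guarantees that a ball
  around \<open>0\<close> of radius \<open>|x|\<close> does not contribute more than the ball around \<open>x\<close>.
\<close>
lemma weighted_riesz_integral_decay_upper:
  fixes \<alpha> \<sigma> \<tau> :: real
  assumes \<alpha>: "\<alpha> < real CARD('n::finite)" and \<sigma>: "0 \<le> \<sigma>" "\<sigma> < \<alpha>" and "0 \<le> \<tau>"
    and \<tau>\<sigma>: "\<alpha> < \<tau> + \<sigma>" "\<tau> + \<sigma> < real CARD('n)"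
  obtains K where "K > 0"
    "\<And>x :: real ^ 'n. weighted_riesz_integral \<alpha> \<sigma> (\<lambda>y. (1 + norm y) powr (-\<tau>)) x
       \<le> ennreal (K * (1 + norm x) powr (-(\<tau> + \<sigma> - \<alpha>)))"
proof -
  define n where "n = real CARD('n)"
  define m where "m = n - \<alpha>"
  define s where "s = \<tau> + \<sigma> - \<alpha>"
  have n: "real DIM(real ^ 'n) = n" by (simp add: n_def)
  have \<gamma>: "n < m + \<tau> + \<sigma>" "0 \<le> \<sigma> + m" "\<sigma> + m < n" "0 \<le> \<tau> + \<sigma>" "\<tau> + \<sigma> < n"
    using assms by (auto simp: m_def n_def)
  obtain K1 where K1: "K1 > 0" "\<And>(x :: real ^ 'n) R. R > 0 \<Longrightarrow>
      (\<integral>\<^sup>+ y. ennreal (indicator (- ball x R) y * norm (x - y) powr (-(m + \<tau> + \<sigma>))) \<partial>lebesgue)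
        \<le> ennreal (K1 * R powr (n - (m + \<tau> + \<sigma>)))"
    using nn_integral_norm_powr_compl_ball_le[where 'a = "real ^ 'n", unfolded n, OF \<gamma>(1)] by blast
  obtain K2 where K2: "K2 > 0" "\<And>(x :: real ^ 'n) R. R > 0 \<Longrightarrow>
      (\<integral>\<^sup>+ y. ennreal (indicator (ball x R) y * norm (x - y) powr (-(\<sigma> + m))) \<partial>lebesgue)
        \<le> ennreal (K2 * R powr (n - (\<sigma> + m)))"
    using nn_integral_norm_powr_ball_le[where 'a = "real ^ 'n", unfolded n, OF \<gamma>(2,3)] by blast
  obtain K3 where K3: "K3 > 0" "\<And>(x :: real ^ 'n) R. R > 0 \<Longrightarrow>
      (\<integral>\<^sup>+ y. ennreal (indicator (ball x R) y * norm (x - y) powr (-(\<tau> + \<sigma>))) \<partial>lebesgue)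
        \<le> ennreal (K3 * R powr (n - (\<tau> + \<sigma>)))"
    using nn_integral_norm_powr_ball_le[where 'a = "real ^ 'n", unfolded n, OF \<gamma>(4,5)] by blast
  define K where "K = 2 powr m * 2 powr (-s) * K1 + (2 powr \<tau> * 3 powr (\<alpha> - \<sigma>) * K2
      + (4 powr m * 2 powr (n - \<tau> - \<sigma>) * K3 + 3 powr s * K2))"
  have "weighted_riesz_integral \<alpha> \<sigma> (\<lambda>y. (1 + norm y) powr (-\<tau>)) x
       \<le> ennreal (K * (1 + norm x) powr (-s))" for x :: "real ^ 'n"
  proof -
    define r where "r = 1 + norm x"
    have r: "r \<ge> 1" "r > 0" by (auto simp: r_def add_pos_nonneg)
    define T1 where "T1 y = indicator (- ball 0 (2 * r)) y * norm (0 - y) powr (-(m + \<tau> + \<sigma>))" for y :: "real ^ 'n"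
    define T2 where "T2 y = indicator (ball x (3 * r)) y * norm (x - y) powr (-(\<sigma> + m))" for y :: "real ^ 'n"
    define T3 where "T3 y = indicator (ball 0 (2 * r)) y * norm (0 - y) powr (-(\<tau> + \<sigma>))" for y :: "real ^ 'n"
    define T4 where "T4 y = indicator (ball 0 1) y * norm (0 - y) powr (-(\<sigma> + m))" for y :: "real ^ 'n"
    have meas: "T1 \<in> borel_measurable lebesgue" "T2 \<in> borel_measurable lebesgue"
      "T3 \<in> borel_measurable lebesgue" "T4 \<in> borel_measurable lebesgue"
      unfolding T1_def[abs_def] T2_def[abs_def] T3_def[abs_def] T4_def[abs_def]
      by (auto intro!: borel_measurable_indicator_norm_powr simp del: diff_0 norm_minus_cancel)
    have nonneg: "0 \<le> T1 y" "0 \<le> T2 y" "0 \<le> T3 y" "0 \<le> T4 y" for y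
      by (simp_all add: T1_def T2_def T3_def T4_def)
    have T_le: "(\<integral>\<^sup>+ y. ennreal (T1 y) \<partial>lebesgue) \<le> ennreal (K1 * (2 * r) powr (n - (m + \<tau> + \<sigma>)))"
      "(\<integral>\<^sup>+ y. ennreal (T2 y) \<partial>lebesgue) \<le> ennreal (K2 * (3 * r) powr (n - (\<sigma> + m)))"
      "(\<integral>\<^sup>+ y. ennreal (T3 y) \<partial>lebesgue) \<le> ennreal (K3 * (2 * r) powr (n - (\<tau> + \<sigma>)))"
      "(\<integral>\<^sup>+ y. ennreal (T4 y) \<partial>lebesgue) \<le> ennreal (K2 * 1 powr (n - (\<sigma> + m)))"
      unfolding T1_def T2_def T3_def T4_def using r
      by (intro K1(2) K2(2) K3(2); simp)+
    have "(1 + norm y) powr (-\<tau>) / (norm (x - y) powr m * norm y powr \<sigma>)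
        \<le> 2 powr m * T1 y + ((2 / r) powr \<tau> * T2 y + ((4 / r) powr m * T3 y + (3 / r) powr s * T4 y))" for y
    proof (cases "y = 0 \<or> y = x")
      case True
      then show ?thesis using nonneg[of y] by (auto intro!: add_nonneg_nonneg mult_nonneg_nonneg)
    next
      case False
      have "norm x \<le> norm (x - y) + norm y" "norm y \<le> norm x + norm (x - y)" "norm (x - y) \<le> norm x + norm y"
        using norm_triangle_ineq[of "x - y" y] norm_triangle_ineq4[of x "x - y"] norm_triangle_ineq4[of x y]
        by auto
      then have "(1 + norm y) powr (-\<tau>) / (norm (x - y) powr m * norm y powr \<sigma>)
          \<le> 2 powr m * (if 2 * r \<le> norm y then norm y powr (-(m + \<tau> + \<sigma>)) else 0)
           + ((2 / r) powr \<tau> * (if norm (x - y) < 3 * r then norm (x - y) powr (-(\<sigma> + m)) else 0)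
           + ((4 / r) powr m * (if norm y < 2 * r then norm y powr (-(\<tau> + \<sigma>)) else 0)
           + (3 / r) powr s * (if norm y < 1 then norm y powr (-(\<sigma> + m)) else 0)))"
        unfolding r_def using False assms
        by (intro riesz_kernel_split) (auto simp: m_def n_def s_def)
      moreover have "T1 y = (if 2 * r \<le> norm y then norm y powr (-(m + \<tau> + \<sigma>)) else 0)"
        "T2 y = (if norm (x - y) < 3 * r then norm (x - y) powr (-(\<sigma> + m)) else 0)"
        "T3 y = (if norm y < 2 * r then norm y powr (-(\<tau> + \<sigma>)) else 0)"
        "T4 y = (if norm y < 1 then norm y powr (-(\<sigma> + m)) else 0)"
        by (auto simp: T1_def T2_def T3_def T4_def dist_norm)
      ultimately show ?thesis by (simp only:)
    qed
    then have "weighted_riesz_integral \<alpha> \<sigma> (\<lambda>y. (1 + norm y) powr (-\<tau>)) x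
      \<le> (\<integral>\<^sup>+ y. ennreal (2 powr m * T1 y + ((2 / r) powr \<tau> * T2 y
            + ((4 / r) powr m * T3 y + (3 / r) powr s * T4 y))) \<partial>lebesgue)"
      unfolding weighted_riesz_integral_def m_def n_def by (intro nn_integral_mono ennreal_leI)
    also have "\<dots> \<le> ennreal (2 powr m * (K1 * (2 * r) powr (n - (m + \<tau> + \<sigma>)))
        + ((2 / r) powr \<tau> * (K2 * (3 * r) powr (n - (\<sigma> + m)))
        + ((4 / r) powr m * (K3 * (2 * r) powr (n - (\<tau> + \<sigma>)))
        + (3 / r) powr s * (K2 * 1 powr (n - (\<sigma> + m))))))"
      using nonneg K1(1) K2(1) K3(1) r
      by (intro nn_integral_add_le nn_integral_cmult_le borel_measurable_times borel_measurable_add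
          borel_measurable_const meas T_le
          add_nonneg_nonneg mult_nonneg_nonneg) auto
    also have "2 powr m * (K1 * (2 * r) powr (n - (m + \<tau> + \<sigma>)))
        + ((2 / r) powr \<tau> * (K2 * (3 * r) powr (n - (\<sigma> + m)))
        + ((4 / r) powr m * (K3 * (2 * r) powr (n - (\<tau> + \<sigma>)))
        + (3 / r) powr s * (K2 * 1 powr (n - (\<sigma> + m))))) = K * r powr (-s)"
    proof -
      have "2 powr m * (K1 * (2 * r) powr (n - (m + \<tau> + \<sigma>))) = 2 powr m * 2 powr (-s) * K1 * r powr (-s)"
        using r by (simp add: powr_mult m_def s_def algebra_simps)
      moreover have "(2 / r) powr \<tau> * (K2 * (3 * r) powr (n - (\<sigma> + m)))
          = 2 powr \<tau> * 3 powr (\<alpha> - \<sigma>) * K2 * r powr (-s)"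
        using r by (simp add: powr_mult powr_divide m_def s_def powr_diff powr_add field_simps)
      moreover have "(4 / r) powr m * (K3 * (2 * r) powr (n - (\<tau> + \<sigma>)))
          = 4 powr m * 2 powr (n - \<tau> - \<sigma>) * K3 * r powr (-s)"
        using r by (simp add: powr_mult powr_divide m_def s_def powr_diff powr_add field_simps)
      moreover have "(3 / r) powr s * (K2 * 1 powr (n - (\<sigma> + m))) = 3 powr s * K2 * r powr (-s)"
        using r by (simp add: powr_divide powr_minus field_simps)
      ultimately show ?thesis by (simp only: K_def distrib_right)
    qed
    finally show ?thesis by (simp add: r_def)
  qed
  moreover have "K > 0"
    using K1(1) K2(1) K3(1) unfolding K_def by (intro add_pos_pos mult_pos_pos) auto
  ultimately show thesis using that by (simp add: s_def)
qed

text \<open>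
  It suffices to integrate over the ball of radius \<open>r = 1 + |x|\<close> around \<open>0\<close>: there \<open>|x - y| \<le> 2 r\<close> and
  \<open>1 + |y| \<le> 2 r\<close>, so the integrand is at least a multiple of \<open>r\<close> to the power \<open>-\<tau> - \<sigma> - (n - \<alpha>)\<close>, and
  the ball has volume of order \<open>r ^ n\<close>.
\<close>
lemma weighted_riesz_integral_decay_lower:
  fixes \<alpha> \<sigma> \<tau> :: real
  assumes \<alpha>: "\<alpha> < real CARD('n::finite)" and \<sigma>: "0 \<le> \<sigma>" and "0 \<le> \<tau>"
  obtains k where "k > 0"
    "\<And>x :: real ^ 'n. ennreal (k * (1 + norm x) powr (-(\<tau> + \<sigma> - \<alpha>)))
       \<le> weighted_riesz_integral \<alpha> \<sigma> (\<lambda>y. (1 + norm y) powr (-\<tau>)) x"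
proof -
  define n where "n = real CARD('n)"
  define m where "m = n - \<alpha>"
  define \<kappa> where "\<kappa> = unit_ball_vol (real DIM(real ^ 'n))"
  define k where "k = 2 powr (-\<tau>) * 2 powr (-m) * \<kappa>"
  have "ennreal (k * (1 + norm x) powr (-(\<tau> + \<sigma> - \<alpha>)))
       \<le> weighted_riesz_integral \<alpha> \<sigma> (\<lambda>y. (1 + norm y) powr (-\<tau>)) x" for x :: "real ^ 'n"
  proof -
    define r where "r = 1 + norm x"
    have r: "r \<ge> 1" "r > 0" by (auto simp: r_def add_pos_nonneg)
    \<comment> \<open>at \<open>0\<close> and at \<open>x\<close> the integrand is \<open>0\<close> by the conventions for \<open>powr\<close> and division\<close>
    define A where "A = ball (0 :: real ^ 'n) r - {0, x}"
    have "emeasure lebesgue A = emeasure lebesgue (ball (0 :: real ^ 'n) r)"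
      unfolding A_def
      by (intro emeasure_Diff_null_set null_sets_completionI finite_imp_null_set_lborel) auto
    also have "\<dots> = ennreal (\<kappa> * r powr n)"
      using r by (simp add: emeasure_ball \<kappa>_def n_def powr_realpow)
    finally have A: "emeasure lebesgue A = ennreal (\<kappa> * r powr n)" .
    define h where "h = (2 * r) powr (-\<tau>) * (2 * r) powr (-m) * r powr (-\<sigma>)"
    have "k * r powr (-(\<tau> + \<sigma> - \<alpha>)) = h * (\<kappa> * r powr n)"
      using r by (simp add: h_def k_def powr_mult m_def powr_diff powr_add powr_minus field_simps)
    then have "ennreal (k * r powr (-(\<tau> + \<sigma> - \<alpha>))) = ennreal h * emeasure lebesgue A"
      by (simp add: A ennreal_mult' h_def)
    also have "\<dots> \<le> weighted_riesz_integral \<alpha> \<sigma> (\<lambda>y. (1 + norm y) powr (-\<tau>)) x"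
      unfolding weighted_riesz_integral_def
    proof (rule nn_integral_ge_const_mult_emeasure)
      fix y assume y: "y \<in> A"
      have "norm (x - y) \<le> 2 * r"
        using y norm_triangle_ineq4[of x y] by (auto simp: A_def r_def)
      then have "h \<le> (1 + norm y) powr (-\<tau>) * norm (x - y) powr (-m) * norm y powr (-\<sigma>)"
        unfolding h_def using y assms r
        by (intro mult_mono powr_mono2') (auto simp: A_def m_def n_def add_pos_nonneg)
      then show "h \<le> (1 + norm y) powr (-\<tau>) / (norm (x - y) powr (real CARD('n) - \<alpha>) * norm y powr \<sigma>)"
        by (simp only: m_def n_def powr_minus divide_inverse inverse_mult_distrib mult.assoc)
    qed (auto simp: A_def h_def)
    finally show ?thesis by (simp add: r_def)
  qed
  moreover have "k > 0" by (simp add: k_def \<kappa>_def)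
  ultimately show thesis using that by blast
qed

section \<open>Double bounded coefficients\<close>

text \<open>
  A double bounded coefficient is exactly the freedom to replace an equation by a two-sided
  estimate: the quotient of the two sides serves as the coefficient.
\<close>
lemma ex_double_bounded_factor:
  fixes f :: "'a \<Rightarrow> real" and W :: "'a \<Rightarrow> ennreal"
  assumes f: "\<And>x. f x > 0" and "k > 0" and "K > 0"
    and lower: "\<And>x. ennreal (k * f x) \<le> W x" and upper: "\<And>x. W x \<le> ennreal (K * f x)"
  shows "\<exists>c. double_bounded c \<and> (\<forall>x. ennreal (f x) = ennreal (c x) * W x)"
proof -
  define w where "w x = enn2real (W x)" for x
  have W: "W x = ennreal (w x)" for x
    using le_less_trans[OF upper[of x]] by (simp add: w_def)
  have w: "k * f x \<le> w x" "w x \<le> K * f x" for x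
    using lower[of x] upper[of x] mult_pos_pos[OF \<open>k > 0\<close> f[of x]] mult_pos_pos[OF \<open>K > 0\<close> f[of x]]
    by (auto simp: W ennreal_le_iff2)
  have w0: "w x > 0" for x
    using w(1)[of x] mult_pos_pos[OF \<open>k > 0\<close> f[of x]] by linarith
  define C where "C = max K (1 / k)"
  have C: "C > 0" "K \<le> C" "1 / k \<le> C" using \<open>K > 0\<close> by (auto simp: C_def)
  have "1 / C \<le> f x / w x \<and> f x / w x \<le> C" for x
  proof
    have "w x \<le> C * f x"
      using w(2)[of x] mult_right_mono[OF C(2), of "f x"] f[of x] by linarith
    then show "1 / C \<le> f x / w x" using C w0[of x] by (simp add: field_simps)
    have "f x \<le> (1 / k) * w x" using w(1)[of x] \<open>k > 0\<close> by (simp add: field_simps)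
    also have "\<dots> \<le> C * w x" using C w0[of x] by (intro mult_right_mono) auto
    finally show "f x / w x \<le> C" using w0[of x] by (simp add: field_simps)
  qed
  then have "double_bounded (\<lambda>x. f x / w x)" using C unfolding double_bounded_def by blast
  moreover have "ennreal (f x) = ennreal (f x / w x) * W x" for x
    using w0[of x] f[of x] by (simp add: W flip: ennreal_mult')
  ultimately show ?thesis by (intro exI[of _ "\<lambda>x. f x / w x"]) auto
qed

text \<open>
  With \<open>\<tau> = t q\<close> the condition \<open>s = t q + \<sigma> - \<alpha>\<close> is the balance of powers of the equation, and
  \<open>0 < s < n - \<alpha>\<close> is the condition \<open>\<alpha> < \<tau> + \<sigma> < n\<close> of the decay estimates.
\<close>
lemma ex_double_bounded_riesz_power:
  fixes \<alpha> \<sigma> q s t :: real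
  assumes \<alpha>: "\<alpha> < real CARD('n::finite)" and \<sigma>: "0 \<le> \<sigma>" "\<sigma> < \<alpha>" and "0 \<le> q" "0 \<le> t"
    and "0 < s" "s < real CARD('n) - \<alpha>" and s: "s = t * q + \<sigma> - \<alpha>"
  shows "\<exists>c. double_bounded c \<and> (\<forall>x :: real ^ 'n. ennreal ((1 + norm x) powr (-s)) =
           ennreal (c x) * weighted_riesz_integral \<alpha> \<sigma> (\<lambda>y. ((1 + norm y) powr (-t)) powr q) x)"
proof -
  have tq: "0 \<le> t * q" "\<alpha> < t * q + \<sigma>" "t * q + \<sigma> < real CARD('n)"
    using assms by auto
  obtain K where "K > 0" "\<And>x :: real ^ 'n. weighted_riesz_integral \<alpha> \<sigma> (\<lambda>y. (1 + norm y) powr (-(t * q))) x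
       \<le> ennreal (K * (1 + norm x) powr (-s))"
    using weighted_riesz_integral_decay_upper[OF \<alpha> \<sigma> tq] unfolding s by blast
  moreover obtain k where "k > 0" "\<And>x :: real ^ 'n. ennreal (k * (1 + norm x) powr (-s))
       \<le> weighted_riesz_integral \<alpha> \<sigma> (\<lambda>y. (1 + norm y) powr (-(t * q))) x"
    using weighted_riesz_integral_decay_lower[OF \<alpha> \<sigma>(1) tq(1)] unfolding s by blast
  moreover have "(1 + norm x) powr (-s) > 0" for x :: "real ^ 'n"
    by (simp add: add_pos_nonneg less_imp_neq[symmetric])
  ultimately show ?thesis
    by (simp add: powr_powr ex_double_bounded_factor)
qed

section \<open>A superlinear recursion\<close>

lemma not_superexponential_if_exponentially_bounded:
  fixes M :: "nat \<Rightarrow> real"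
  assumes pos: "\<And>k. M k > 0" and bound: "\<And>k. M k \<le> K * \<rho> ^ k" and "\<rho> > 0"
    and growth: "\<And>L. eventually (\<lambda>k. L * M k \<le> M (Suc k)) sequentially"
  shows False
proof -
  obtain k0 where k0: "\<And>k. k \<ge> k0 \<Longrightarrow> 2 * \<rho> * M k \<le> M (Suc k)"
    using growth[of "2 * \<rho>"] by (auto simp: eventually_sequentially)
  have low: "(2 * \<rho>) ^ j * M k0 \<le> M (k0 + j)" for j
  proof (induction j)
    case (Suc j)
    have "(2 * \<rho>) ^ Suc j * M k0 = 2 * \<rho> * ((2 * \<rho>) ^ j * M k0)" by simp
    also have "\<dots> \<le> 2 * \<rho> * M (k0 + j)" using Suc \<open>\<rho> > 0\<close> by (intro mult_left_mono) auto
    also have "\<dots> \<le> M (k0 + Suc j)" using k0[of "k0 + j"] by simp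
    finally show ?case .
  qed simp
  have "2 ^ j \<le> K * \<rho> ^ k0 / M k0" for j
  proof -
    have "\<rho> ^ j * (2 ^ j * M k0) \<le> \<rho> ^ j * (K * \<rho> ^ k0)"
      using order_trans[OF low[of j] bound] by (simp add: power_mult_distrib power_add mult_ac)
    then show ?thesis using pos[of k0] \<open>\<rho> > 0\<close> by (simp add: field_simps)
  qed
  moreover obtain j where "K * \<rho> ^ k0 / M k0 < 2 ^ j"
    using real_arch_pow[of 2] by auto
  ultimately show False by (meson not_le)
qed

text \<open>
  In each excluded case the quotients \<open>M (Suc k) / M k\<close> tend to infinity, against the exponential
  bound. If \<open>s \<le> 1\<close>, the bound gives \<open>M k powr s \<ge> M k * (K * 4 powr (m * k)) powr (s - 1)\<close>; the powers
  of \<open>4 powr m\<close> cancel and the quotient is at least a multiple of \<open>4 powr (D * k)\<close>. If \<open>s > 1\<close> and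
  \<open>D \<ge> m * (s - 1)\<close>, the coefficient of the recursion stays at least \<open>c\<close>, hence \<open>M\<close> grows at least
  linearly, and the quotient is at least \<open>c * M k powr (s - 1)\<close>. This case includes the
  borderline \<open>D = m * (s - 1)\<close>.
\<close>
lemma exponents_if_exponentially_bounded:
  fixes M :: "nat \<Rightarrow> real" and s m D :: real
  assumes pos: "\<And>k. M k > 0" and "c > 0" and "D > 0"
    and bound: "\<And>k. M k \<le> K * (4 powr m) ^ k"
    and step: "\<And>k. M k + c * (4 powr (D + m - m * s)) ^ k * M k powr s \<le> M (Suc k)"
  shows "s > 1 \<and> D < m * (s - 1)"
proof (rule ccontr)
  assume neg: "\<not> ?thesis"
  have K: "K > 0" using bound[of 0] pos[of 0] by simp
  have "\<exists>L0. filterlim L0 at_top sequentially \<and> (\<forall>k. L0 k * M k \<le> M (Suc k))"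
  proof (cases "s \<le> 1")
    case True
    define L0 where "L0 k = c * K powr (s - 1) * (4 powr D) ^ k" for k :: nat
    have "4 powr D > (4::real) powr 0" using \<open>D > 0\<close> by (intro powr_less_mono) auto
    then have "filterlim (\<lambda>k. (4 powr D) ^ k :: real) at_top sequentially"
      by (intro filterlim_at_infinity_imp_filterlim_at_top[OF filterlim_realpow_sequentially_gt1]) auto
    then have "filterlim L0 at_top sequentially"
      unfolding L0_def using \<open>c > 0\<close> K
      by (intro filterlim_tendsto_pos_mult_at_top[OF tendsto_const]) auto
    moreover have "L0 k * M k \<le> M (Suc k)" for k
    proof -
      have e: "(4 powr t) ^ k = (4::real) powr (t * real k)" for t
        by (simp add: powr_powr flip: powr_realpow)
      have "L0 k * M k = c * (4 powr (D + m - m * s)) ^ k * ((K * (4 powr m) ^ k) powr (s - 1) * M k)"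
        using K unfolding L0_def e
        by (simp add: powr_mult powr_powr mult_ac algebra_simps flip: powr_add)
      also have "\<dots> \<le> c * (4 powr (D + m - m * s)) ^ k * (M k powr (s - 1) * M k)"
        using pos[of k] True bound[of k] \<open>c > 0\<close>
        by (intro mult_left_mono mult_right_mono powr_mono2') (auto intro: less_imp_le)
      also have "M k powr (s - 1) * M k = M k powr s"
        using pos[of k] by (simp add: powr_diff)
      also have "c * (4 powr (D + m - m * s)) ^ k * M k powr s \<le> M (Suc k)"
        using step[of k] pos[of k] by linarith
      finally show ?thesis .
    qed
    ultimately show ?thesis by blast
  next
    case False
    with neg have E: "D + m - m * s \<ge> 0" by (simp add: algebra_simps)
    have E1: "(4 powr (D + m - m * s)) ^ k \<ge> (1::real)" for k
      using E by (intro one_le_power ge_one_powr_ge_zero) auto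
    have step': "M k + c * M k powr s \<le> M (Suc k)" for k
    proof -
      have "c * 1 * M k powr s \<le> c * (4 powr (D + m - m * s)) ^ k * M k powr s"
        using E1[of k] \<open>c > 0\<close> by (intro mult_right_mono mult_left_mono) auto
      then show ?thesis using step[of k] by simp
    qed
    have lin: "M 0 \<le> M k \<and> real k * (c * M 0 powr s) \<le> M k" for k
    proof (induction k)
      case (Suc k)
      have "c * M 0 powr s \<le> c * M k powr s"
        using Suc pos[of 0] False \<open>c > 0\<close> by (intro mult_left_mono powr_mono2) auto
      moreover have "0 \<le> c * M 0 powr s" using \<open>c > 0\<close> by simp
      ultimately show ?case using Suc step'[of k] by (simp add: algebra_simps)
    qed (use pos[of 0] in auto)
    have "filterlim (\<lambda>k. real k * (c * M 0 powr s)) at_top sequentially"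
      using pos[of 0] \<open>c > 0\<close>
      by (intro filterlim_at_top_mult_tendsto_pos[OF tendsto_const] filterlim_real_sequentially) auto
    then have "filterlim M at_top sequentially"
      by (rule filterlim_at_top_mono) (use lin in auto)
    then have "filterlim (\<lambda>k. c * M k powr (s - 1)) at_top sequentially"
      using \<open>c > 0\<close> False
      by (intro filterlim_tendsto_pos_mult_at_top[OF tendsto_const]
          filterlim_compose[OF real_powr_at_top]) auto
    moreover have "c * M k powr (s - 1) * M k \<le> M (Suc k)" for k
      using step'[of k] pos[of k] by (simp add: powr_diff)
    ultimately show ?thesis by blast
  qed
  then obtain L0 where lim: "filterlim L0 at_top sequentially"
    and L0: "\<And>k. L0 k * M k \<le> M (Suc k)" by blast
  have "eventually (\<lambda>k. L * M k \<le> M (Suc k)) sequentially" for L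
  proof -
    have "eventually (\<lambda>k. L \<le> L0 k) sequentially"
      using lim by (simp add: filterlim_at_top)
    then show ?thesis
    proof eventually_elim
      case (elim k)
      then have "L * M k \<le> L0 k * M k" using pos[of k] by simp
      then show ?case using L0[of k] by linarith
    qed
  qed
  then show False
    by (rule not_superexponential_if_exponentially_bounded[OF pos bound, rotated]) auto
qed

section \<open>Exponents of supersolutions\<close>

text \<open>
  \<open>M R\<close> is the mass of \<open>v powr q / |y| powr \<sigma>\<^sub>1\<close> in the ball of radius \<open>R\<close>. It is \<open>O(R powr m)\<close> because the
  potential at the origin is finite. Moreover, up to constants,
  \<^item> \<open>u \<ge> R powr (-m) * M R\<close> for \<open>R \<le> |x| < 2 R\<close>, since the kernel is at least \<open>(3 R) powr (-m)\<close> there;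
  \<^item> inserting this in the second inequality, \<open>v \<ge> R powr (\<alpha> - \<sigma>\<^sub>2 - m p) * M R powr p\<close> for
    \<open>2 R \<le> |x| < 4 R\<close>;
  \<^item> integrating \<open>v powr q / |y| powr \<sigma>\<^sub>1\<close> over this annulus, which is disjoint from the ball of radius
    \<open>R\<close>, bounds the growth of the mass from \<open>R\<close> to \<open>4 R\<close> from below.

  The annuli for \<open>u\<close> and \<open>v\<close> are consecutive so that the kernel is never evaluated on the diagonal,
  where its value is a convention.
\<close>
lemma supersolution_mass_growth:
  fixes \<alpha> p q \<sigma>\<^sub>1 \<sigma>\<^sub>2 C :: real and u v :: "real ^ 'n::finite \<Rightarrow> real"
  assumes \<alpha>: "\<alpha> < real CARD('n)" and "p > 0" "q > 0" and \<sigma>: "0 \<le> \<sigma>\<^sub>1" "0 \<le> \<sigma>\<^sub>2"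
    and v_meas: "v \<in> borel_measurable lebesgue"
    and u: "\<And>x. u x > 0" and v: "\<And>x. v x > 0" and C: "C > 0"
    and ineq_u: "\<And>x. weighted_riesz_integral \<alpha> \<sigma>\<^sub>1 (\<lambda>y. v y powr q) x \<le> ennreal (C * u x)"
    and ineq_v: "\<And>x. weighted_riesz_integral \<alpha> \<sigma>\<^sub>2 (\<lambda>y. u y powr p) x \<le> ennreal (C * v x)"
  defines "m \<equiv> real CARD('n) - \<alpha>" and "D \<equiv> \<alpha> * (q + 1) - (\<sigma>\<^sub>1 + \<sigma>\<^sub>2 * q)"
  obtains M :: "real \<Rightarrow> real" and c K where "c > 0"
    "\<And>R. R > 0 \<Longrightarrow> M R > 0" "\<And>R. R > 0 \<Longrightarrow> M R \<le> K * R powr m"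
    "\<And>R. R > 0 \<Longrightarrow> M R + c * R powr (D + m - m * (p * q)) * M R powr (p * q) \<le> M (4 * R)"
proof -
  define n where "n = real CARD('n)"
  define \<kappa> where "\<kappa> = unit_ball_vol (real DIM(real ^ 'n))"
  have \<kappa>: "\<kappa> > 0" by (simp add: \<kappa>_def)
  have m: "m > 0" using \<alpha> by (simp add: m_def)
  have nm: "real CARD('n) - \<alpha> = m" by (simp add: m_def)
  define w where "w y = v y powr q / norm y powr \<sigma>\<^sub>1" for y
  define w' where "w' x y = v y powr q / (norm (x - y) powr m * norm y powr \<sigma>\<^sub>1)" for x y
  define I where "I R = (\<integral>\<^sup>+ y. ennreal (w y) * indicator (ball 0 R) y \<partial>lebesgue)" for R
  define M where "M R = enn2real (I R)" for R
  have norm_meas: "(\<lambda>y :: real ^ 'n. norm (x - y)) \<in> borel_measurable lebesgue" for x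
    by (rule borel_measurable_lebesgue_if_borel) measurable
  have norm_meas': "(\<lambda>y :: real ^ 'n. norm y) \<in> borel_measurable lebesgue"
    by (rule borel_measurable_lebesgue_if_borel) measurable
  note [measurable] = v_meas norm_meas norm_meas'
  have w_meas [measurable]: "w \<in> borel_measurable lebesgue" unfolding w_def[abs_def] by measurable
  have [measurable]: "w' x \<in> borel_measurable lebesgue" for x unfolding w'_def[abs_def] by measurable
  have w_ind_meas: "(\<lambda>y. ennreal (w y) * indicator A y) \<in> borel_measurable lebesgue"
    if "A \<in> sets borel" for A
    using that by (intro borel_measurable_times_ennreal measurable_compose[OF w_meas measurable_ennreal]
        borel_measurable_indicator) auto
  have w0: "0 \<le> w y" for y by (simp add: w_def)
  have W1: "weighted_riesz_integral \<alpha> \<sigma>\<^sub>1 (\<lambda>y. v y powr q) x = (\<integral>\<^sup>+ y. ennreal (w' x y) \<partial>lebesgue)" for x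
    by (simp add: weighted_riesz_integral_def w'_def nm)

  \<comment> \<open>The kernel is at least \<open>L powr (-m)\<close> on the ball; used with \<open>x = 0\<close>, \<open>L = R\<close> and with \<open>R \<le> |x| < 2 R\<close>, \<open>L = 3 R\<close>.\<close>
  have kernel: "I R \<le> ennreal (L powr m * (C * u x))"
    if "\<And>y. norm y < R \<Longrightarrow> y \<noteq> 0 \<Longrightarrow> x \<noteq> y \<and> norm (x - y) \<le> L" for R L x
  proof -
    have "I R \<le> (\<integral>\<^sup>+ y. ennreal (L powr m) * ennreal (w' x y) \<partial>lebesgue)"
      unfolding I_def
    proof (rule nn_integral_mono)
      fix y :: "real ^ 'n"
      show "ennreal (w y) * indicator (ball 0 R) y \<le> ennreal (L powr m) * ennreal (w' x y)"
      proof (cases "norm y < R \<and> y \<noteq> 0")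
        case True
        then have xy: "0 < norm (x - y)" "norm (x - y) \<le> L" using that[of y] by auto
        have "w y = norm (x - y) powr m * w' x y"
          using xy by (simp add: w_def w'_def)
        also have "\<dots> \<le> L powr m * w' x y"
          using xy m by (intro mult_right_mono powr_mono2) (auto simp: w'_def)
        finally show ?thesis using True by (simp add: ennreal_leI flip: ennreal_mult')
      qed (auto simp: w_def)
    qed
    also have "\<dots> = ennreal (L powr m) * weighted_riesz_integral \<alpha> \<sigma>\<^sub>1 (\<lambda>y. v y powr q) x"
      unfolding W1 by (intro nn_integral_cmult) measurable
    also have "\<dots> \<le> ennreal (L powr m) * ennreal (C * u x)"
      by (intro mult_left_mono ineq_u) auto
    finally show ?thesis by (simp add: ennreal_mult')
  qed
  have I_bound: "I R \<le> ennreal (R powr m * (C * u 0))" for R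
    by (rule kernel) auto
  have I: "I R = ennreal (M R)" for R
    using le_less_trans[OF I_bound[of R]] by (simp add: M_def)
  have M0: "0 \<le> M R" for R by (simp add: M_def)
  have M_bound: "M R \<le> C * u 0 * R powr m" for R
    using I_bound[of R] C u[of 0] by (simp add: I ennreal_le_iff mult_ac)
  have M_pos: "M R > 0" if R: "R > 0" for R
  proof (rule ccontr)
    assume "\<not> M R > 0"
    then have "I R = 0" using M0[of R] by (simp add: I)
    then have "AE y in lebesgue. ennreal (w y) * indicator (ball 0 R) y = 0"
      unfolding I_def by (subst (asm) nn_integral_0_iff_AE) (auto intro!: w_ind_meas)
    then have "AE y in lebesgue. y \<notin> ball (0 :: real ^ 'n) R - {0}"
    proof eventually_elim
      case (elim y)
      then show ?case using v[of y] by (auto simp: w_def indicator_def split: if_splits)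
    qed
    moreover have "ball (0 :: real ^ 'n) R - {0} \<in> sets lebesgue" by auto
    ultimately have "ball (0 :: real ^ 'n) R - {0} \<in> null_sets lebesgue"
      by (subst AE_iff_null_sets)
    then have "emeasure lebesgue (ball (0 :: real ^ 'n) R - {0}) = 0"
      by (rule null_setsD1)
    moreover have "emeasure lebesgue (ball (0 :: real ^ 'n) R - {0}) = emeasure lebesgue (ball (0 :: real ^ 'n) R)"
      by (intro emeasure_Diff_null_set null_sets_completionI finite_imp_null_set_lborel) auto
    ultimately show False using R unit_ball_vol_pos[of "real CARD('n)"] by (simp add: emeasure_ball)
  qed

  define a0 where "a0 = 1 / (C * 3 powr m)"
  define b0 where "b0 = \<kappa> * a0 powr p * 6 powr (-m) * 2 powr (-\<sigma>\<^sub>2) / C"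
  define c where "c = \<kappa> * 2 powr n * b0 powr q * 4 powr (-\<sigma>\<^sub>1)"
  have pos: "a0 > 0" "b0 > 0" "c > 0" using \<kappa> C by (auto simp: a0_def b0_def c_def)
  have "M R + c * R powr (D + m - m * (p * q)) * M R powr (p * q) \<le> M (4 * R)" if R: "R > 0" for R
  proof -
    define A where "A = a0 * R powr (-m) * M R"
    define B where "B = b0 * R powr (\<alpha> - \<sigma>\<^sub>2 - m * p) * M R powr p"
    note MR = M_pos[OF R]
    have A: "A > 0" and B: "B > 0" using pos R MR by (auto simp: A_def B_def)
    have uA: "A \<le> u x" if x: "R \<le> norm x" "norm x < 2 * R" for x
    proof -
      have "I R \<le> ennreal ((3 * R) powr m * (C * u x))"
      proof (rule kernel)
        fix y :: "real ^ 'n" assume "norm y < R"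
        then show "x \<noteq> y \<and> norm (x - y) \<le> 3 * R"
          using x norm_triangle_ineq4[of x y] by auto
      qed
      then have "M R \<le> (3 * R) powr m * (C * u x)"
        using C u[of x] by (simp add: I ennreal_le_iff)
      then show ?thesis
        using R C by (simp add: A_def a0_def powr_mult powr_minus field_simps)
    qed
    have vB: "B \<le> v x" if x: "2 * R \<le> norm x" "norm x < 4 * R" for x
    proof -
      define h where "h = A powr p / ((6 * R) powr m * (2 * R) powr \<sigma>\<^sub>2)"
      have "ennreal (h * (\<kappa> * R ^ DIM(real ^ 'n))) \<le> weighted_riesz_integral \<alpha> \<sigma>\<^sub>2 (\<lambda>y. u y powr p) x"
        unfolding weighted_riesz_integral_def \<kappa>_def nm
      proof (rule nn_integral_ge_annulus[OF R])
        fix y :: "real ^ 'n" assume y: "R \<le> norm y" "norm y < 2 * R"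
        have "x \<noteq> y" "norm (x - y) \<le> 6 * R"
          using x y norm_triangle_ineq4[of x y] by auto
        then show "h \<le> u y powr p / (norm (x - y) powr m * norm y powr \<sigma>\<^sub>2)"
          unfolding h_def using y R A uA[OF y] m \<sigma> \<open>p > 0\<close>
          by (intro frac_le mult_mono powr_mono2 mult_pos_pos) auto
      qed (simp add: h_def)
      also have "\<dots> \<le> ennreal (C * v x)" by (rule ineq_v)
      finally have "h * (\<kappa> * R powr n) \<le> C * v x"
        using C v[of x] R by (simp add: ennreal_le_iff n_def powr_realpow)
      moreover have "h * (\<kappa> * R powr n) = C * B"
      proof -
        have "A powr p = a0 powr p * R powr (- (m * p)) * M R powr p"
          using pos R MR by (simp add: A_def powr_mult powr_powr)
        moreover have "R powr (\<alpha> - \<sigma>\<^sub>2 - m * p) = R powr (- (m * p)) * R powr n * R powr (-m) * R powr (-\<sigma>\<^sub>2)"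
          by (simp add: m_def n_def algebra_simps flip: powr_add)
        ultimately show ?thesis
          using R C by (simp add: h_def B_def b0_def powr_mult powr_minus divide_inverse mult_ac)
      qed
      ultimately show ?thesis using C by simp
    qed
    define k where "k = B powr q / (4 * R) powr \<sigma>\<^sub>1"
    have "ennreal (k * (\<kappa> * (2 * R) ^ DIM(real ^ 'n)))
        \<le> (\<integral>\<^sup>+ y. ennreal (w y * indicator (ball 0 (4 * R) - ball 0 R) y) \<partial>lebesgue)"
      unfolding \<kappa>_def
    proof (rule nn_integral_ge_annulus)
      fix y :: "real ^ 'n" assume y: "2 * R \<le> norm y" "norm y < 2 * (2 * R)"
      have "k \<le> w y"
        unfolding k_def w_def using y R B vB[of y] \<sigma> \<open>q > 0\<close>
        by (intro frac_le powr_mono2) auto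
      then show "k \<le> w y * indicator (ball 0 (4 * R) - ball 0 R) y" using y R by auto
    qed (use R in \<open>auto simp: k_def\<close>)
    then have "I R + ennreal (k * (\<kappa> * (2 * R) powr n))
        \<le> I R + (\<integral>\<^sup>+ y. ennreal (w y) * indicator (ball 0 (4 * R) - ball 0 R) y \<partial>lebesgue)"
      using R by (intro add_left_mono)
        (simp add: n_def powr_realpow ennreal_mult' ennreal_indicator w0)
    also have "\<dots> = (\<integral>\<^sup>+ y. ennreal (w y) * indicator (ball 0 R) y
         + ennreal (w y) * indicator (ball 0 (4 * R) - ball 0 R) y \<partial>lebesgue)"
      unfolding I_def by (subst nn_integral_add) (auto intro!: w_ind_meas)
    also have "\<dots> = I (4 * R)"
      unfolding I_def using R by (intro nn_integral_cong) (auto simp: indicator_def)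
    finally have "M R + k * (\<kappa> * (2 * R) powr n) \<le> M (4 * R)"
      using M0[of R] M0[of "4 * R"] \<kappa> by (simp add: I k_def ennreal_le_iff flip: ennreal_plus)
    moreover have "k * (\<kappa> * (2 * R) powr n) = c * R powr (D + m - m * (p * q)) * M R powr (p * q)"
    proof -
      have "B powr q = b0 powr q * R powr ((\<alpha> - \<sigma>\<^sub>2 - m * p) * q) * M R powr (p * q)"
        using pos R MR by (simp add: B_def powr_mult powr_powr)
      moreover have "R powr (D + m - m * (p * q)) = R powr ((\<alpha> - \<sigma>\<^sub>2 - m * p) * q) * R powr n * R powr (-\<sigma>\<^sub>1)"
        by (simp add: D_def m_def n_def algebra_simps flip: powr_add)
      ultimately show ?thesis
        using R by (simp add: k_def c_def powr_mult powr_minus divide_inverse mult_ac)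
    qed
    ultimately show ?thesis by simp
  qed
  with pos M_pos M_bound show thesis by (intro that[of c M "C * u 0"]) auto
qed

text \<open>
  The mass growth is sampled at the radii \<open>R = 4 ^ k\<close>. The hypotheses \<open>\<sigma>\<^sub>1, \<sigma>\<^sub>2 < \<alpha>\<close> enter through the
  positivity of the numerator \<open>D\<close>.
\<close>
lemma supersolution_exponents:
  fixes \<alpha> p q \<sigma>\<^sub>1 \<sigma>\<^sub>2 C :: real and u v :: "real ^ 'n::finite \<Rightarrow> real"
  assumes \<alpha>: "\<alpha> < real CARD('n)" and pq: "p > 0" "q > 0"
    and \<sigma>: "0 \<le> \<sigma>\<^sub>1" "\<sigma>\<^sub>1 < \<alpha>" "0 \<le> \<sigma>\<^sub>2" "\<sigma>\<^sub>2 < \<alpha>"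
    and v_meas: "v \<in> borel_measurable lebesgue"
    and uv: "\<And>x. u x > 0" "\<And>x. v x > 0" "C > 0"
    and ineq: "\<And>x. weighted_riesz_integral \<alpha> \<sigma>\<^sub>1 (\<lambda>y. v y powr q) x \<le> ennreal (C * u x)"
      "\<And>x. weighted_riesz_integral \<alpha> \<sigma>\<^sub>2 (\<lambda>y. u y powr p) x \<le> ennreal (C * v x)"
  shows "p * q > 1 \<and> (\<alpha> * (q + 1) - (\<sigma>\<^sub>1 + \<sigma>\<^sub>2 * q)) / (p * q - 1) < real CARD('n) - \<alpha>"
proof -
  define m where "m = real CARD('n) - \<alpha>"
  define D where "D = \<alpha> * (q + 1) - (\<sigma>\<^sub>1 + \<sigma>\<^sub>2 * q)"
  obtain M :: "real \<Rightarrow> real" and c K where M: "c > 0" "\<And>R. R > 0 \<Longrightarrow> M R > 0"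
    "\<And>R. R > 0 \<Longrightarrow> M R \<le> K * R powr m"
    "\<And>R. R > 0 \<Longrightarrow> M R + c * R powr (D + m - m * (p * q)) * M R powr (p * q) \<le> M (4 * R)"
    by (rule supersolution_mass_growth[OF \<alpha> pq \<sigma>(1,3) v_meas uv ineq, folded m_def D_def]) (rule that)
  have "D = (\<alpha> - \<sigma>\<^sub>1) + (\<alpha> - \<sigma>\<^sub>2) * q" by (simp add: D_def algebra_simps)
  then have D: "D > 0" using \<sigma> pq by (simp add: add_pos_pos)
  have e: "(4 powr t) ^ k = ((4::real) ^ k) powr t" for t k
    by (simp add: powr_powr mult.commute flip: powr_realpow)
  have "p * q > 1 \<and> D < m * (p * q - 1)"
  proof (rule exponents_if_exponentially_bounded[where M = "\<lambda>k. M (4 ^ k)" and c = c and K = K])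
    show "M (4 ^ k) \<le> K * (4 powr m) ^ k" for k
      using M(3)[of "4 ^ k"] by (simp add: e)
    show "M (4 ^ k) + c * (4 powr (D + m - m * (p * q))) ^ k * M (4 ^ k) powr (p * q) \<le> M (4 ^ Suc k)" for k
      using M(4)[of "4 ^ k"] by (simp add: e)
  qed (use M D in auto)
  then show ?thesis by (simp add: D_def m_def pos_divide_less_eq)
qed

lemma weighted_riesz_integral_le_if_double_bounded:
  assumes C: "C > 0" "1 / C \<le> c x" and eq: "ennreal (u x) = ennreal (c x) * weighted_riesz_integral \<alpha> \<sigma> f x"
  shows "weighted_riesz_integral \<alpha> \<sigma> f x \<le> ennreal (C * u x)"
proof -
  have "weighted_riesz_integral \<alpha> \<sigma> f x = ennreal C * (ennreal (1 / C) * weighted_riesz_integral \<alpha> \<sigma> f x)"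
    using C by (simp add: mult.assoc[symmetric] flip: ennreal_mult')
  also have "\<dots> \<le> ennreal C * (ennreal (c x) * weighted_riesz_integral \<alpha> \<sigma> f x)"
    using C by (intro mult_left_mono mult_right_mono ennreal_leI) auto
  also have "\<dots> = ennreal (C * u x)" using C by (simp add: eq[symmetric] ennreal_mult')
  finally show ?thesis .
qed

section \<open>The characterisation of solvability\<close>

theorem theorem2:
  fixes \<alpha> p q \<sigma>\<^sub>1 \<sigma>\<^sub>2 :: real
  assumes "CARD('n::finite) \<ge> 3"
    and "0 < \<alpha>" and "\<alpha> < real CARD('n)"
    and "p > 0" and "q > 0"
    and "0 \<le> \<sigma>\<^sub>1" and "\<sigma>\<^sub>1 < \<alpha>" and "0 \<le> \<sigma>\<^sub>2" and "\<sigma>\<^sub>2 < \<alpha>"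
  shows "(\<exists>c\<^sub>1 c\<^sub>2 u v :: real ^ 'n \<Rightarrow> real.
            double_bounded c\<^sub>1 \<and> double_bounded c\<^sub>2 \<and>
            positive_solution \<alpha> p q \<sigma>\<^sub>1 \<sigma>\<^sub>2 c\<^sub>1 c\<^sub>2 u v)
     \<longleftrightarrow> p * q > 1 \<and>
         max ((\<alpha> * (q + 1) - (\<sigma>\<^sub>1 + \<sigma>\<^sub>2 * q)) / (p * q - 1))
             ((\<alpha> * (p + 1) - (\<sigma>\<^sub>2 + \<sigma>\<^sub>1 * p)) / (p * q - 1))
           < real CARD('n) - \<alpha>"
    (is "?lhs \<longleftrightarrow> ?rhs")
proof
  assume ?lhs
  then obtain c\<^sub>1 c\<^sub>2 and u v :: "real ^ 'n \<Rightarrow> real" where c: "double_bounded c\<^sub>1" "double_bounded c\<^sub>2"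
    and meas: "u \<in> borel_measurable lebesgue" "v \<in> borel_measurable lebesgue"
    and pos: "\<And>x. u x > 0" "\<And>x. v x > 0"
    and eq: "\<And>x. ennreal (u x) = ennreal (c\<^sub>1 x) * weighted_riesz_integral \<alpha> \<sigma>\<^sub>1 (\<lambda>y. v y powr q) x"
      "\<And>x. ennreal (v x) = ennreal (c\<^sub>2 x) * weighted_riesz_integral \<alpha> \<sigma>\<^sub>2 (\<lambda>y. u y powr p) x"
    unfolding positive_solution_def by blast
  obtain C\<^sub>1 C\<^sub>2 where C\<^sub>1: "C\<^sub>1 > 0" "\<And>x. 1 / C\<^sub>1 \<le> c\<^sub>1 x" and C\<^sub>2: "C\<^sub>2 > 0" "\<And>x. 1 / C\<^sub>2 \<le> c\<^sub>2 x"
    using c unfolding double_bounded_def by blast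
  \<comment> \<open>One constant for both inequalities, so that the roles of the two equations can be exchanged.\<close>
  define C where "C = max C\<^sub>1 C\<^sub>2"
  have C: "C > 0" using C\<^sub>1 by (simp add: C_def)
  have "C\<^sub>1 * u x \<le> C * u x" "C\<^sub>2 * v x \<le> C * v x" for x
    using pos[of x] by (auto simp: C_def)
  then have ineq: "weighted_riesz_integral \<alpha> \<sigma>\<^sub>1 (\<lambda>y. v y powr q) x \<le> ennreal (C * u x)"
      "weighted_riesz_integral \<alpha> \<sigma>\<^sub>2 (\<lambda>y. u y powr p) x \<le> ennreal (C * v x)" for x
    using weighted_riesz_integral_le_if_double_bounded[where x = x and u = u and c = c\<^sub>1, OF C\<^sub>1 eq(1)]
      weighted_riesz_integral_le_if_double_bounded[where x = x and u = v and c = c\<^sub>2, OF C\<^sub>2 eq(2)]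
    by (meson order_trans ennreal_leI)+
  have "p * q > 1 \<and> (\<alpha> * (q + 1) - (\<sigma>\<^sub>1 + \<sigma>\<^sub>2 * q)) / (p * q - 1) < real CARD('n) - \<alpha>"
    using assms by (intro supersolution_exponents[where C = C and u = u and v = v] meas pos C ineq)
  moreover have "q * p > 1 \<and> (\<alpha> * (p + 1) - (\<sigma>\<^sub>2 + \<sigma>\<^sub>1 * p)) / (q * p - 1) < real CARD('n) - \<alpha>"
    using assms by (intro supersolution_exponents[where C = C and u = v and v = u] meas pos C ineq)
  ultimately show ?rhs by (simp add: mult.commute)
next
  assume rhs: ?rhs
  \<comment> \<open>The exponents of the power solution: the unique solution of the linear system \<open>st\<close> below.\<close>
  define s where "s = (\<alpha> * (q + 1) - (\<sigma>\<^sub>1 + \<sigma>\<^sub>2 * q)) / (p * q - 1)"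
  define t where "t = (\<alpha> * (p + 1) - (\<sigma>\<^sub>2 + \<sigma>\<^sub>1 * p)) / (p * q - 1)"
  have pq: "p * q - 1 > 0" using rhs by simp
  have num: "\<alpha> * (q + 1) - (\<sigma>\<^sub>1 + \<sigma>\<^sub>2 * q) = (\<alpha> - \<sigma>\<^sub>1) + (\<alpha> - \<sigma>\<^sub>2) * q"
    "\<alpha> * (p + 1) - (\<sigma>\<^sub>2 + \<sigma>\<^sub>1 * p) = (\<alpha> - \<sigma>\<^sub>2) + (\<alpha> - \<sigma>\<^sub>1) * p"
    by (simp_all add: algebra_simps)
  have s: "0 < s" "s < real CARD('n) - \<alpha>" and t: "0 < t" "t < real CARD('n) - \<alpha>"
    using rhs pq assms by (auto simp: s_def t_def num intro!: divide_pos_pos add_pos_pos)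
  have "s * (p * q - 1) = \<alpha> * (q + 1) - (\<sigma>\<^sub>1 + \<sigma>\<^sub>2 * q)" "t * (p * q - 1) = \<alpha> * (p + 1) - (\<sigma>\<^sub>2 + \<sigma>\<^sub>1 * p)"
    using pq by (auto simp: s_def t_def)
  then have "(s - (t * q + \<sigma>\<^sub>1 - \<alpha>)) * (p * q - 1) = 0" "(t - (s * p + \<sigma>\<^sub>2 - \<alpha>)) * (p * q - 1) = 0"
    by algebra+
  then have st: "s = t * q + \<sigma>\<^sub>1 - \<alpha>" "t = s * p + \<sigma>\<^sub>2 - \<alpha>" using pq by auto
  define u v :: "real ^ 'n \<Rightarrow> real" where "u x = (1 + norm x) powr (-s)" and "v x = (1 + norm x) powr (-t)" for x
  have pos: "1 + norm x > 0" for x :: "real ^ 'n" by (simp add: add_pos_nonneg)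
  have "(\<lambda>x. (1 + norm x) powr a) \<in> borel_measurable (lebesgue :: (real ^ 'n) measure)" for a
    by (rule borel_measurable_lebesgue_if_borel) measurable
  then have meas: "u \<in> borel_measurable lebesgue" "v \<in> borel_measurable lebesgue"
    by (simp_all add: u_def[abs_def] v_def[abs_def])
  obtain c\<^sub>1 where c\<^sub>1: "double_bounded c\<^sub>1"
    "\<And>x. ennreal (u x) = ennreal (c\<^sub>1 x) * weighted_riesz_integral \<alpha> \<sigma>\<^sub>1 (\<lambda>y. v y powr q) x"
    using ex_double_bounded_riesz_power[OF assms(3,6,7) _ _ s st(1)] assms t unfolding u_def v_def by auto
  obtain c\<^sub>2 where c\<^sub>2: "double_bounded c\<^sub>2"
    "\<And>x. ennreal (v x) = ennreal (c\<^sub>2 x) * weighted_riesz_integral \<alpha> \<sigma>\<^sub>2 (\<lambda>y. u y powr p) x"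
    using ex_double_bounded_riesz_power[OF assms(3,8,9) _ _ t st(2)] assms s unfolding u_def v_def by auto
  have "positive_solution \<alpha> p q \<sigma>\<^sub>1 \<sigma>\<^sub>2 c\<^sub>1 c\<^sub>2 u v"
    unfolding positive_solution_def
    using meas c\<^sub>1(2) c\<^sub>2(2) pos by (auto simp: u_def v_def less_imp_neq[symmetric])
  then show ?lhs using c\<^sub>1(1) c\<^sub>2(1) by blast
qed

end
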